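(* Let $T>0$, let $m,n\ge1$ be integers, let $n-1<\alpha\le n$ and $\alpha>\alpha_1>\alpha_2>\cdots>\alpha_m>0$, and for $i=1,\dots,m$ let $n_i$ be the positive integer with $n_i-1<\alpha_i\le n_i$. Let $f:[0,T]\times\mathbb R^{m+1}\to\mathbb R$ be continuous and $x_0^0,\dots,x_{n-1}^0\in\mathbb R$. Consider the initial value problem (P), for a continuous function $x:[0,T]\to\mathbb R$, $$D_*^\alpha x(t)=f\big(t,x(t),D_*^{\alpha_1}x(t),\dots,D_*^{\alpha_m}x(t)\big),\quad 0<t\le T,\qquad x^{(j)}(0)=x_j^0,\quad j=0,1,\dots,n-1,$$ and the fractional integral equation (E) $$y(t)=f\Big(t,\;I^\alpha y(t)+\sum_{k=0}^{n-1}x_k^0\frac{t^k}{k!},\;\Big\{I^{\alpha-\alpha_i}y(t)+D^{\alpha_i}\Big(\sum_{k=n_i}^{n-1}x_k^0\frac{t^k}{k!}\Big)\Big\}_{i=1}^m\Big).$$ (a) If $x$ is a solution of (P) and $D_*^\alpha x(t)=y(t)$, then $y\in C[0,T]$ and $y$ is a solution of (E). (b) If $y\in C[0,T]$ is a solution of (E) and $$x(t):=I^\alpha y(t)+\sum_{k=0}^{n-1}x_k^0\frac{t^k}{k!},$$ then $x$ is a solution of (P).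
   Context: For $\beta>0$, $I^\beta y(t)=\frac1{\Gamma(\beta)}\int_0^t(t-\tau)^{\beta-1}y(\tau)\,d\tau$ is the fractional integral of order $\beta$. For $\beta>0$ with $l-1<\beta\le l$, $l\in\mathbb N$, and $u\in C^l[0,T]$, the Riemann–Liouville derivative of order $\beta$ is $D^\beta u(t)=\frac{d^l}{dt^l}\frac{1}{\Gamma(l-\beta)}\int_0^t(t-\tau)^{l-\beta-1}u(\tau)\,d\tau$ and the Caputo derivative of order $\beta$ is $D_*^\beta u(t)=\frac{1}{\Gamma(l-\beta)}\int_0^t(t-\tau)^{l-\beta-1}\frac{d^l}{d\tau^l}u(\tau)\,d\tau$ (for $\beta=l$ both are $u^{(l)}$). A function $x$ is called a solution of (P) if it satisfies the equation and the initial conditions in (P) and $D_*^\alpha x\in C[0,T]$. An empty sum is $0$.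
   Formalization: For functions not in C^l[0,T], where the Caputo derivative is not defined above, it is taken as the Riemann–Liouville derivative of u minus its Taylor polynomial at 0 (with u in C^{l-1}); otherwise (b) fails, e.g. α=1/2, f=1, x=x_0+t^{1/2}/Γ(3/2). *)

theory Defs
  imports "HOL-Analysis.Analysis"
begin

text \<open>
  Functions on \<open>[0,T]\<close> are total functions of which only the values on \<open>{0..T}\<close> matter; derivatives
  are taken within \<open>{0..T}\<close>, hence one-sided at both end points.
\<close>

primrec nderiv :: "real \<Rightarrow> nat \<Rightarrow> (real \<Rightarrow> real) \<Rightarrow> real \<Rightarrow> real" where
  "nderiv T 0 u = u"
| "nderiv T (Suc k) u = (\<lambda>t. vector_derivative (nderiv T k u) (at t within {0..T}))"

definition ndifferentiable :: "real \<Rightarrow> nat \<Rightarrow> (real \<Rightarrow> real) \<Rightarrow> bool" where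
  "ndifferentiable T l u \<longleftrightarrow> (\<forall>k<l. nderiv T k u differentiable_on {0..T})"

definition C_class :: "real \<Rightarrow> nat \<Rightarrow> (real \<Rightarrow> real) \<Rightarrow> bool" where
  "C_class T l u \<longleftrightarrow> ndifferentiable T l u \<and> continuous_on {0..T} (nderiv T l u)"

text \<open>
  The order \<open>0\<close> is included, with the identity as integral of order \<open>0\<close>. With it, the
  formulas for fractional derivatives below give the ordinary derivative at integer orders.
\<close>

definition frac_int :: "real \<Rightarrow> (real \<Rightarrow> real) \<Rightarrow> real \<Rightarrow> real" where
  "frac_int \<beta> y t =
     (if \<beta> = 0 then y t
      else (1 / Gamma \<beta>) * integral {0..t} (\<lambda>\<tau>. (t - \<tau>) powr (\<beta> - 1) * y \<tau>))"

text \<open>For \<open>\<beta> > 0\<close> this is the natural number \<open>l\<close> with \<open>l - 1 < \<beta> \<le> l\<close>.\<close>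

definition frac_ord :: "real \<Rightarrow> nat" where
  "frac_ord \<beta> = nat \<lceil>\<beta>\<rceil>"

definition RL_deriv :: "real \<Rightarrow> real \<Rightarrow> (real \<Rightarrow> real) \<Rightarrow> real \<Rightarrow> real" where
  "RL_deriv T \<beta> u = nderiv T (frac_ord \<beta>) (frac_int (real (frac_ord \<beta>) - \<beta>) u)"

definition RL_differentiable :: "real \<Rightarrow> real \<Rightarrow> (real \<Rightarrow> real) \<Rightarrow> bool" where
  "RL_differentiable T \<beta> u \<longleftrightarrow>
     ndifferentiable T (frac_ord \<beta>) (frac_int (real (frac_ord \<beta>) - \<beta>) u)"

definition taylor_remainder :: "real \<Rightarrow> nat \<Rightarrow> (real \<Rightarrow> real) \<Rightarrow> real \<Rightarrow> real" where
  "taylor_remainder T l u t = u t - (\<Sum>k<l. nderiv T k u 0 * t ^ k / fact k)"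

text \<open>
  On \<open>C\<^sup>l[0,T]\<close> the Caputo derivative is the fractional integral of order \<open>l - \<beta>\<close> of the \<open>l\<close>-th
  derivative. This class is too small for initial value problems: \<open>I\<^sup>\<alpha> y\<close> with \<open>y\<close> merely
  continuous need not be \<open>l\<close> times differentiable anywhere. For example, with \<open>\<alpha> = 1/2\<close>, a
  Weierstrass function that vanishes at \<open>0\<close> and has a Hoelder exponent above \<open>1/2\<close> is \<open>I\<^sup>\<alpha> y\<close> for a
  continuous \<open>y\<close>. For functions outside \<open>C\<^sup>l[0,T]\<close> the usual extension is therefore taken: the
  Riemann--Liouville derivative of \<open>u\<close> minus its Taylor polynomial of degree \<open>l - 1\<close> at \<open>0\<close>,
  which coincides with the first formula whenever \<open>u\<close> is in \<open>C\<^sup>l[0,T]\<close>.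
\<close>

definition caputo_deriv :: "real \<Rightarrow> real \<Rightarrow> (real \<Rightarrow> real) \<Rightarrow> real \<Rightarrow> real" where
  "caputo_deriv T \<beta> u =
     (if C_class T (frac_ord \<beta>) u
      then frac_int (real (frac_ord \<beta>) - \<beta>) (nderiv T (frac_ord \<beta>) u)
      else RL_deriv T \<beta> (taylor_remainder T (frac_ord \<beta>) u))"

definition caputo_differentiable :: "real \<Rightarrow> real \<Rightarrow> (real \<Rightarrow> real) \<Rightarrow> bool" where
  "caputo_differentiable T \<beta> u \<longleftrightarrow>
     C_class T (frac_ord \<beta>) u \<or>
     C_class T (frac_ord \<beta> - 1) u \<and> RL_differentiable T \<beta> (taylor_remainder T (frac_ord \<beta>) u)"

text \<open>
  The right-hand side \<open>f\<close> lives on \<open>[0,T] \<times> \<real> \<times> \<real>\<^sup>m\<close>, where \<open>\<real>\<^sup>m\<close> is \<open>{1..m} \<rightarrow>\<^sub>E UNIV\<close> with the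
  topology of pointwise convergence. The orders are \<open>a 1, \<dots>, a m\<close>.
\<close>

definition solves_ivp ::
  "real \<Rightarrow> nat \<Rightarrow> nat \<Rightarrow> real \<Rightarrow> (nat \<Rightarrow> real) \<Rightarrow> (real \<times> real \<times> (nat \<Rightarrow> real) \<Rightarrow> real) \<Rightarrow>
   (nat \<Rightarrow> real) \<Rightarrow> (real \<Rightarrow> real) \<Rightarrow> bool" where
  "solves_ivp T m n \<alpha> a f x0 x \<longleftrightarrow>
     continuous_on {0..T} x \<and>
     caputo_differentiable T \<alpha> x \<and>
     (\<forall>i\<in>{1..m}. caputo_differentiable T (a i) x) \<and>
     (\<forall>t\<in>{0<..T}. caputo_deriv T \<alpha> x t =
        f (t, x t, \<lambda>i\<in>{1..m}. caputo_deriv T (a i) x t)) \<and>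
     (\<forall>j<n. nderiv T j x 0 = x0 j) \<and>
     continuous_on {0..T} (caputo_deriv T \<alpha> x)"

definition solves_integral_eq ::
  "real \<Rightarrow> nat \<Rightarrow> nat \<Rightarrow> real \<Rightarrow> (nat \<Rightarrow> real) \<Rightarrow> (nat \<Rightarrow> nat) \<Rightarrow>
   (real \<times> real \<times> (nat \<Rightarrow> real) \<Rightarrow> real) \<Rightarrow> (nat \<Rightarrow> real) \<Rightarrow> (real \<Rightarrow> real) \<Rightarrow> bool" where
  "solves_integral_eq T m n \<alpha> a N f x0 y \<longleftrightarrow>
     (\<forall>t\<in>{0..T}. y t =
        f (t,
           frac_int \<alpha> y t + (\<Sum>k<n. x0 k * t ^ k / fact k),
           \<lambda>i\<in>{1..m}. frac_int (\<alpha> - a i) y t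
             + RL_deriv T (a i) (\<lambda>s. \<Sum>k\<in>{N i..<n}. x0 k * s ^ k / fact k) t))"

end

theory Submission
  imports Defs
begin

text \<open>
  The Caputo derivative of order \<open>\<beta>\<close> and \<open>I\<^sup>\<beta>\<close> are inverse to each other up to Taylor polynomials:
  \<open>u = P + I\<^sup>\<beta> z\<close> with \<open>z\<close> continuous and \<open>P\<close> of degree less than \<open>\<lceil>\<beta>\<rceil>\<close> means exactly that \<open>u\<close> has the
  continuous Caputo derivative \<open>z\<close> and Taylor polynomial \<open>P\<close>. This rests on the semigroup law
  \<open>I\<^sup>\<alpha> I\<^sup>\<beta> = I\<^bsup>\<alpha> + \<beta>\<^esup>\<close>, which also makes \<open>I\<^sup>\<beta>\<close> injective. Order \<open>\<alpha>\<close> gives the equivalence of the initial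
  value problem with \<open>x = I\<^sup>\<alpha> y + P\<close>, and order \<open>\<alpha>\<^sub>i\<close>, after writing \<open>I\<^sup>\<alpha> y\<close> and the monomials of degree
  at least \<open>n\<^sub>i\<close> as \<open>I\<close> of order \<open>\<alpha>\<^sub>i\<close> of continuous functions, gives the arguments of \<open>f\<close>. At \<open>t = 0\<close>
  the integral equation follows from continuity of both sides.
\<close>

section \<open>The fractional integral on continuous functions\<close>

text \<open>The substitution \<open>\<tau> = t * s\<close> reduces this to the Beta integral over
  \<open>{0..1}\<close>. The kernel, the power and the differential contribute the exponents
  \<open>\<beta> - 1\<close>, \<open>p\<close> and \<open>1\<close> of \<open>t\<close>.\<close>

lemma has_integral_kernel_powr:
  fixes \<beta> p t :: real
  assumes "\<beta> > 0" "p > -1" "t > 0"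
  shows "((\<lambda>\<tau>. (t - \<tau>) powr (\<beta> - 1) * \<tau> powr p) has_integral
           Beta (p + 1) \<beta> * t powr (p + \<beta>)) {0..t}"
proof -
  let ?f = "\<lambda>s::real. s powr p * (1 - s) powr (\<beta> - 1)"
  have "(?f has_integral Beta (p + 1) \<beta>) {0..1}"
    using has_integral_Beta_real[of "p + 1" \<beta>] assms by simp
  from has_integral_stretch_real[OF this, of "1 / t"] assms
  have "((\<lambda>x. ?f (x / t)) has_integral t * Beta (p + 1) \<beta>) ((\<lambda>x. x * t) ` {0..1})"
    by simp
  moreover have "(\<lambda>x. x * t) ` {0..1} = {0..t}"
    using assms by (auto simp: image_iff intro!: bexI[of _ "_ / t"] mult_le_one)
  ultimately have "((\<lambda>x. t powr (p + \<beta> - 1) * ?f (x / t)) has_integral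
      t powr (p + \<beta> - 1) * (t * Beta (p + 1) \<beta>)) {0..t}"
    by (intro has_integral_mult_right) simp
  moreover have "t powr (p + \<beta> - 1) * (t * Beta (p + 1) \<beta>) = Beta (p + 1) \<beta> * t powr (p + \<beta>)"
    using assms by (simp add: powr_diff)
  moreover have "t powr (p + \<beta> - 1) * ?f (x / t) = (t - x) powr (\<beta> - 1) * x powr p"
    if "x \<in> {0..t}" for x
  proof -
    have "1 - x / t = (t - x) / t"
      using assms by (simp add: field_simps)
    then have "?f (x / t) = x powr p / t powr p * ((t - x) powr (\<beta> - 1) / t powr (\<beta> - 1))"
      using that assms by (simp add: powr_divide)
    moreover have "t powr (p + \<beta> - 1) = t powr p * t powr (\<beta> - 1)"
      by (simp add: powr_add[symmetric] algebra_simps)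
    ultimately show ?thesis
      using assms by (simp add: field_simps)
  qed
  ultimately show ?thesis
    by (metis (no_types, lifting) has_integral_cong)
qed

text \<open>Kept apart from the \<open>powr\<close> version because \<open>0 powr 0 = 0\<close>
  while \<open>0 ^ 0 = 1\<close>: for \<open>k = 0\<close> the integrands differ at the single point
  \<open>0\<close>.\<close>

lemma has_integral_kernel_power:
  fixes \<beta> t :: real
  assumes "\<beta> > 0" "t > 0"
  shows "((\<lambda>\<tau>. (t - \<tau>) powr (\<beta> - 1) * \<tau> ^ k) has_integral
           Beta (real k + 1) \<beta> * t powr (real k + \<beta>)) {0..t}"
proof (rule has_integral_spike_finite[OF _ _ has_integral_kernel_powr])
  show "finite {0::real}" by simp
qed (use assms in \<open>auto simp: powr_realpow\<close>)

text \<open>Absolute integrability is the form that survives multiplication by a bounded measurable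
  function, hence by any continuous \<open>y\<close>, although the kernel is unbounded for
  \<open>\<beta> < 1\<close>.\<close>

lemma kernel_absolutely_integrable:
  fixes \<beta> t :: real
  assumes "\<beta> > 0"
  shows "(\<lambda>\<tau>. (t - \<tau>) powr (\<beta> - 1)) absolutely_integrable_on {0..t}"
proof (cases "t > 0")
  case True
  have "(\<lambda>\<tau>. (t - \<tau>) powr (\<beta> - 1)) integrable_on {0..t}"
    using has_integral_kernel_power[OF assms True, of 0] by (auto simp: integrable_on_def)
  then show ?thesis
    by (intro nonnegative_absolutely_integrable_1) auto
next
  case False
  then have "t < 0 \<or> t = 0" by auto
  then show ?thesis
    by (intro absolutely_integrable_continuous_real) auto
qed

lemma kernel_mult_integrable:
  fixes \<beta> t :: real and y :: "real \<Rightarrow> real"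
  assumes "\<beta> > 0" "continuous_on {0..t} y"
  shows "(\<lambda>\<tau>. (t - \<tau>) powr (\<beta> - 1) * y \<tau>) integrable_on {0..t}"
proof -
  have "(\<lambda>\<tau>. y \<tau> * (t - \<tau>) powr (\<beta> - 1)) absolutely_integrable_on {0..t}"
    using assms
    by (intro absolutely_integrable_bounded_measurable_product_real kernel_absolutely_integrable
        continuous_imp_measurable_on_sets_lebesgue compact_imp_bounded compact_continuous_image) auto
  then show ?thesis
    by (simp add: mult.commute set_lebesgue_integral_eq_integral(1))
qed

section \<open>Linearity of the fractional integral\<close>

lemma frac_int_0 [simp]: "frac_int 0 y = y"
  by (simp add: frac_int_def fun_eq_iff)

lemma frac_int_at_0: "\<beta> \<noteq> 0 \<Longrightarrow> frac_int \<beta> y 0 = 0"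
  by (simp add: frac_int_def)

lemma frac_int_cong:
  assumes "\<And>s. s \<in> {0..t} \<Longrightarrow> y s = z s" "t \<ge> 0"
  shows "frac_int \<beta> y t = frac_int \<beta> z t"
proof -
  have "integral {0..t} (\<lambda>\<tau>. (t - \<tau>) powr (\<beta> - 1) * y \<tau>) =
        integral {0..t} (\<lambda>\<tau>. (t - \<tau>) powr (\<beta> - 1) * z \<tau>)"
    using assms by (intro integral_cong) auto
  then show ?thesis
    using assms by (simp add: frac_int_def)
qed

lemma frac_int_cmult: "frac_int \<beta> (\<lambda>s. c * y s) t = c * frac_int \<beta> y t"
proof -
  have "(\<lambda>\<tau>. (t - \<tau>) powr (\<beta> - 1) * (c * y \<tau>)) = (\<lambda>\<tau>. c * ((t - \<tau>) powr (\<beta> - 1) * y \<tau>))"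
    by (simp add: fun_eq_iff mult_ac)
  then show ?thesis
    by (simp add: frac_int_def)
qed

lemma frac_int_add:
  assumes "\<beta> \<ge> 0" "continuous_on {0..t} y" "continuous_on {0..t} z"
  shows "frac_int \<beta> (\<lambda>s. y s + z s) t = frac_int \<beta> y t + frac_int \<beta> z t"
proof (cases "\<beta> = 0")
  case False
  with assms have "\<beta> > 0" by simp
  have "integral {0..t} (\<lambda>\<tau>. (t - \<tau>) powr (\<beta> - 1) * (y \<tau> + z \<tau>)) =
        integral {0..t} (\<lambda>\<tau>. (t - \<tau>) powr (\<beta> - 1) * y \<tau>) +
        integral {0..t} (\<lambda>\<tau>. (t - \<tau>) powr (\<beta> - 1) * z \<tau>)"
    unfolding distrib_left
    using \<open>\<beta> > 0\<close> assms by (intro integral_add kernel_mult_integrable)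
  then show ?thesis
    using False by (simp add: frac_int_def add_divide_distrib)
qed simp

lemma frac_int_diff:
  assumes "\<beta> \<ge> 0" "continuous_on {0..t} y" "continuous_on {0..t} z"
  shows "frac_int \<beta> (\<lambda>s. y s - z s) t = frac_int \<beta> y t - frac_int \<beta> z t"
  using frac_int_add[of \<beta> t y "\<lambda>s. -1 * z s"] frac_int_cmult[of \<beta> "-1" z t] assms
  by (simp add: continuous_on_minus)

lemma frac_int_sum:
  assumes "\<beta> \<ge> 0" "finite K" "\<And>k. k \<in> K \<Longrightarrow> continuous_on {0..t} (y k)"
  shows "frac_int \<beta> (\<lambda>s. \<Sum>k\<in>K. y k s) t = (\<Sum>k\<in>K. frac_int \<beta> (y k) t)"
  using assms(2,3)
proof (induction K rule: finite_induct)
  case empty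
  show ?case using frac_int_cmult[of \<beta> 0 "\<lambda>_. 0" t] by simp
next
  case (insert k K)
  then show ?case
    using assms(1) by (simp add: frac_int_add continuous_on_sum)
qed

section \<open>Fractional integrals of powers\<close>

lemma frac_int_powr:
  assumes "\<beta> > 0" "p \<ge> 0" "t \<ge> 0"
  shows "frac_int \<beta> (\<lambda>s. s powr p) t = Gamma (p + 1) / Gamma (p + 1 + \<beta>) * t powr (p + \<beta>)"
proof (cases "t = 0")
  case True
  with assms show ?thesis by (simp add: frac_int_def)
next
  case False
  have "Gamma \<beta> \<noteq> 0" using Gamma_real_pos[OF assms(1)] by simp
  with False assms show ?thesis
    using integral_unique[OF has_integral_kernel_powr[of \<beta> p t]]
    by (simp add: frac_int_def Beta_def)
qed

lemma frac_int_power: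
  assumes "\<beta> > 0" "t \<ge> 0"
  shows "frac_int \<beta> (\<lambda>s. s ^ k) t = fact k / Gamma (real k + 1 + \<beta>) * t powr (real k + \<beta>)"
proof (cases "t = 0")
  case True
  with assms show ?thesis by (simp add: frac_int_def)
next
  case False
  have "Gamma \<beta> \<noteq> 0" using Gamma_real_pos[OF assms(1)] by simp
  moreover have "Gamma (real k + 1) = fact k"
    using Gamma_fact[of k, where 'a = real] by (simp add: add.commute)
  ultimately show ?thesis
    using False assms integral_unique[OF has_integral_kernel_power[of \<beta> t k]]
    by (simp add: frac_int_def Beta_def)
qed

lemma frac_int_nat_power:
  assumes "t \<ge> 0"
  shows "frac_int (real N) (\<lambda>s. s ^ k / fact k) t = t ^ (k + N) / fact (k + N)"
proof (cases "N = 0")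
  case False
  have "Gamma (real k + 1 + real N) = fact (k + N)"
    using Gamma_fact[of "k + N", where 'a = real] by (simp add: add_ac)
  moreover have "t powr (real k + real N) = t ^ (k + N)"
    using powr_realpow'[of t "k + N"] assms False by (simp add: add_nonneg_eq_0_iff)
  moreover have "frac_int (real N) (\<lambda>s. s ^ k / fact k) t =
      1 / fact k * frac_int (real N) (\<lambda>s. s ^ k) t"
    using frac_int_cmult[of "real N" "1 / fact k" "\<lambda>s. s ^ k" t] by simp
  ultimately show ?thesis
    using frac_int_power[of "real N" t k] False assms by simp
qed simp

lemma frac_int_const:
  assumes "t \<ge> 0"
  shows "frac_int (real N) (\<lambda>s. c) t = c * t ^ N / fact N"
  using frac_int_nat_power[of t N 0] frac_int_cmult[of "real N" c "\<lambda>s. 1" t] assms by simp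

text \<open>The inner integral is a multiple of a power with real exponent
  \<open>real k + \<beta>\<close>. After the outer integral, the factor
  \<open>Gamma (real k + \<beta> + 1)\<close> cancels.\<close>

lemma frac_int_semigroup_power:
  assumes "\<alpha> > 0" "\<beta> > 0" "t \<ge> 0"
  shows "frac_int \<alpha> (frac_int \<beta> (\<lambda>s. s ^ k)) t = frac_int (\<alpha> + \<beta>) (\<lambda>s. s ^ k) t"
proof -
  let ?c = "fact k / Gamma (real k + 1 + \<beta>)"
  have "frac_int \<alpha> (frac_int \<beta> (\<lambda>s. s ^ k)) t = frac_int \<alpha> (\<lambda>s. ?c * s powr (real k + \<beta>)) t"
    using assms by (intro frac_int_cong frac_int_power) auto
  also have "\<dots> = ?c * (Gamma (real k + \<beta> + 1) / Gamma (real k + \<beta> + 1 + \<alpha>)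
      * t powr (real k + \<beta> + \<alpha>))"
    using assms by (simp only: frac_int_cmult frac_int_powr)
  also have "\<dots> = frac_int (\<alpha> + \<beta>) (\<lambda>s. s ^ k) t"
  proof -
    have "Gamma (real k + \<beta> + 1) \<noteq> 0"
      by (intro less_imp_neq[symmetric] Gamma_real_pos) (use assms in auto)
    then show ?thesis
      using assms frac_int_power[of "\<alpha> + \<beta>" t k] by (simp add: add_ac)
  qed
  finally show ?thesis .
qed

section \<open>Sup norm bound, continuity and the semigroup law\<close>

text \<open>The constant does not depend on \<open>t\<close>, so the fractional integral is bounded
  in the sup norm on \<open>{0..T}\<close>. This is what carries statements from polynomials over to
  uniform limits.\<close>

lemma frac_int_bound:
  assumes "\<beta> > 0" "0 \<le> t" "t \<le> T" "continuous_on {0..t} y" "\<And>s. s \<in> {0..t} \<Longrightarrow> \<bar>y s\<bar> \<le> B"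
  shows "\<bar>frac_int \<beta> y t\<bar> \<le> B * (T powr \<beta> / Gamma (1 + \<beta>))"
proof -
  have "Gamma \<beta> > 0" "Gamma (1 + \<beta>) > 0" using assms by simp_all
  have "B \<ge> 0" using assms(5)[of t] assms(2) by auto
  have "\<bar>integral {0..t} (\<lambda>\<tau>. (t - \<tau>) powr (\<beta> - 1) * y \<tau>)\<bar>
      \<le> integral {0..t} (\<lambda>\<tau>. (t - \<tau>) powr (\<beta> - 1) * B)"
    unfolding real_norm_def[symmetric]
    using assms by (intro Henstock_Kurzweil_Integration.integral_norm_bound_integral kernel_mult_integrable)
      (auto simp: abs_mult intro: mult_left_mono)
  \<comment> \<open>Writing the constant as \<open>B * s ^ 0\<close> makes the monomial formula with
    \<open>k = 0\<close> applicable.\<close>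
  then have "\<bar>frac_int \<beta> y t\<bar> \<le> frac_int \<beta> (\<lambda>s. B * s ^ 0) t"
    using \<open>Gamma \<beta> > 0\<close> \<open>\<beta> > 0\<close> by (simp add: frac_int_def divide_right_mono)
  also have "\<dots> = B * (t powr \<beta> / Gamma (1 + \<beta>))"
    using frac_int_power[of \<beta> t 0] assms unfolding frac_int_cmult by simp
  also have "\<dots> \<le> B * (T powr \<beta> / Gamma (1 + \<beta>))"
    using \<open>Gamma (1 + \<beta>) > 0\<close> \<open>B \<ge> 0\<close> assms
    by (intro mult_left_mono divide_right_mono powr_mono2) auto
  finally show ?thesis .
qed

lemma polynomial_approx:
  fixes y :: "real \<Rightarrow> real"
  assumes "continuous_on {0..T} y" "\<epsilon> > 0"
  shows "\<exists>c n. \<forall>s\<in>{0..T}. \<bar>y s - (\<Sum>k\<le>n. c k * s ^ k)\<bar> \<le> \<epsilon>"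
proof -
  obtain g where g: "real_polynomial_function g" "\<And>s. s \<in> {0..T} \<Longrightarrow> \<bar>y s - g s\<bar> < \<epsilon>"
    using Stone_Weierstrass_real_polynomial_function[OF _ assms(1,2)] by blast
  then obtain c n where "g = (\<lambda>s. \<Sum>k\<le>n. c k * s ^ k)"
    by (auto simp: real_polynomial_function_iff_sum)
  with g(2) have "\<bar>y s - (\<Sum>k\<le>n. c k * s ^ k)\<bar> \<le> \<epsilon>" if "s \<in> {0..T}" for s
    using that by force
  then show ?thesis by blast
qed

lemma frac_int_polynomial:
  assumes "\<beta> \<ge> 0"
  shows "frac_int \<beta> (\<lambda>s. \<Sum>k\<le>n. c k * s ^ k) t = (\<Sum>k\<le>n. c k * frac_int \<beta> (\<lambda>s. s ^ k) t)"
  using assms by (subst frac_int_sum) (auto simp: frac_int_cmult intro!: continuous_intros)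

text \<open>For a polynomial the integral is an explicit sum of powers
  \<open>t powr (real k + \<beta>)\<close>, which is continuous. By the sup norm bound, the
  integrals of approximating polynomials converge uniformly to that of \<open>y\<close>.\<close>

lemma continuous_on_frac_int:
  assumes "\<beta> \<ge> 0" "continuous_on {0..T} y"
  shows "continuous_on {0..T} (frac_int \<beta> y)"
proof (cases "\<beta> = 0 \<or> T < 0")
  case False
  with assms have "\<beta> > 0" "T \<ge> 0" by auto
  let ?C = "T powr \<beta> / Gamma (1 + \<beta>) + 1"
  have "Gamma (1 + \<beta>) > 0" using \<open>\<beta> > 0\<close> by simp
  then have "T powr \<beta> / Gamma (1 + \<beta>) \<ge> 0" "?C > 0" by (auto intro: add_nonneg_pos)
  have "\<forall>j. \<exists>c n. \<forall>s\<in>{0..T}. \<bar>y s - (\<Sum>k\<le>n. c k * s ^ k)\<bar> \<le> 1 / real (Suc j)"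
    by (intro allI polynomial_approx assms(2)) simp
  then obtain c n where cn:
    "\<And>j s. s \<in> {0..T} \<Longrightarrow> \<bar>y s - (\<Sum>k\<le>n j. c j k * s ^ k)\<bar> \<le> 1 / real (Suc j)"
    by metis
  define P where "P j s = (\<Sum>k\<le>n j. c j k * s ^ k)" for j s
  have P_cont: "continuous_on S (P j)" for j S
    unfolding P_def by (intro continuous_intros)
  have "continuous_on {0..T} (frac_int \<beta> (P j))" for j
  proof -
    have "continuous_on {0..T}
        (\<lambda>t. \<Sum>k\<le>n j. c j k * (fact k / Gamma (real k + 1 + \<beta>) * t powr (real k + \<beta>)))"
      using \<open>\<beta> > 0\<close>
      by (intro continuous_on_sum continuous_on_mult continuous_on_const continuous_on_powr'
          continuous_on_id) auto
    then show ?thesis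
      by (rule continuous_on_eq)
        (use \<open>\<beta> > 0\<close> in \<open>simp add: P_def[abs_def] frac_int_polynomial frac_int_power\<close>)
  qed
  moreover have "uniform_limit {0..T} (\<lambda>j. frac_int \<beta> (P j)) (frac_int \<beta> y) sequentially"
  proof (rule uniform_limitI)
    fix e :: real assume "e > 0"
    then obtain J where J: "?C / e < real J" using reals_Archimedean2 by blast
    show "\<forall>\<^sub>F j in sequentially. \<forall>t\<in>{0..T}. dist (frac_int \<beta> (P j) t) (frac_int \<beta> y t) < e"
    proof (rule eventually_sequentiallyI[of J], rule ballI)
      fix j t assume jt: "J \<le> j" "t \<in> {0..T}"
      have yt: "continuous_on {0..t} y"
        using assms(2) jt(2) by (auto intro: continuous_on_subset)
      have "\<bar>frac_int \<beta> (\<lambda>s. y s - P j s) t\<bar> \<le> 1 / real (Suc j) * (T powr \<beta> / Gamma (1 + \<beta>))"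
        using jt \<open>\<beta> > 0\<close> cn[of _ j] yt P_cont
        by (intro frac_int_bound continuous_on_diff) (auto simp: P_def)
      also have "\<dots> \<le> ?C / real (Suc j)"
        unfolding times_divide_eq_left mult_1 by (intro divide_right_mono) simp_all
      also have "\<dots> < e"
      proof -
        have "?C / e < real (Suc j)" using J jt by simp
        then show ?thesis using \<open>e > 0\<close> by (simp add: field_simps)
      qed
      finally show "dist (frac_int \<beta> (P j) t) (frac_int \<beta> y t) < e"
        using assms(1) yt P_cont by (simp add: frac_int_diff dist_real_def abs_minus_commute)
    qed
  qed
  ultimately show ?thesis
    by (intro uniform_limit_theorem[where F = sequentially and f = "\<lambda>j. frac_int \<beta> (P j)"]) auto
qed (use assms in auto)

text \<open>The semigroup law on monomials is the Beta integral; the sup norm bound and density of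
  polynomials extend it to all continuous functions.\<close>

lemma frac_int_semigroup:
  assumes "\<alpha> \<ge> 0" "\<beta> \<ge> 0" "continuous_on {0..T} y" "t \<in> {0..T}"
  shows "frac_int \<alpha> (frac_int \<beta> y) t = frac_int (\<alpha> + \<beta>) y t"
proof (cases "\<alpha> = 0 \<or> \<beta> = 0")
  case False
  with assms have pos: "\<alpha> > 0" "\<beta> > 0" by auto
  let ?A = "T powr \<alpha> / Gamma (1 + \<alpha>)" and ?B = "T powr \<beta> / Gamma (1 + \<beta>)"
    and ?C = "T powr (\<alpha> + \<beta>) / Gamma (1 + (\<alpha> + \<beta>))"
  let ?D = "\<bar>frac_int \<alpha> (frac_int \<beta> y) t - frac_int (\<alpha> + \<beta>) y t\<bar>"
  \<comment> \<open>Both sides are compared with their values at a polynomial within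
    \<open>\<epsilon>\<close> of \<open>y\<close>. The iterated integral contributes the error
    \<open>\<epsilon> * ?B * ?A\<close>, the single one \<open>\<epsilon> * ?C\<close>.\<close>
  have bound: "?D \<le> \<epsilon> * (?B * ?A + ?C)" if "\<epsilon> > 0" for \<epsilon>
  proof -
    obtain c n where cn: "\<And>s. s \<in> {0..T} \<Longrightarrow> \<bar>y s - (\<Sum>k\<le>n. c k * s ^ k)\<bar> \<le> \<epsilon>"
      using polynomial_approx[OF assms(3) \<open>\<epsilon> > 0\<close>] by blast
    define P where "P s = (\<Sum>k\<le>n. c k * s ^ k)" for s
    have P_cont: "continuous_on S P" for S
      unfolding P_def by (intro continuous_intros)
    have y_cont: "continuous_on {0..s} y" if "s \<in> {0..T}" for s
      using assms(3) that by (auto intro: continuous_on_subset)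
    have Iy_cont: "continuous_on {0..t} (frac_int \<beta> y)" and IP_cont: "continuous_on {0..t} (frac_int \<beta> P)"
      using assms y_cont P_cont by (auto intro: continuous_on_frac_int)
    have P_semigroup: "frac_int \<alpha> (frac_int \<beta> P) t = frac_int (\<alpha> + \<beta>) P t"
    proof -
      have "frac_int \<alpha> (frac_int \<beta> P) t =
          frac_int \<alpha> (\<lambda>s. \<Sum>k\<le>n. c k * frac_int \<beta> (\<lambda>s. s ^ k) s) t"
        unfolding P_def using assms by (intro frac_int_cong frac_int_polynomial) auto
      also have "\<dots> = (\<Sum>k\<le>n. c k * frac_int \<alpha> (frac_int \<beta> (\<lambda>s. s ^ k)) t)"
        using assms
        by (subst frac_int_sum)
          (auto simp: frac_int_cmult intro!: continuous_intros continuous_on_frac_int)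
      also have "\<dots> = frac_int (\<alpha> + \<beta>) P t"
        unfolding P_def using assms pos by (simp add: frac_int_polynomial frac_int_semigroup_power)
      finally show ?thesis .
    qed
    have "\<bar>frac_int \<beta> y s - frac_int \<beta> P s\<bar> \<le> \<epsilon> * ?B" if "s \<in> {0..t}" for s
    proof -
      have "\<bar>frac_int \<beta> (\<lambda>s. y s - P s) s\<bar> \<le> \<epsilon> * ?B"
        using that assms pos cn y_cont P_cont
        by (intro frac_int_bound continuous_on_diff) (auto simp: P_def)
      then show ?thesis
        using that assms y_cont P_cont by (simp add: frac_int_diff)
    qed
    then have "\<bar>frac_int \<alpha> (\<lambda>s. frac_int \<beta> y s - frac_int \<beta> P s) t\<bar> \<le> \<epsilon> * ?B * ?A"
      using assms pos Iy_cont IP_cont by (intro frac_int_bound continuous_on_diff) auto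
    then have "\<bar>frac_int \<alpha> (frac_int \<beta> y) t - frac_int \<alpha> (frac_int \<beta> P) t\<bar> \<le> \<epsilon> * ?B * ?A"
      using assms Iy_cont IP_cont by (simp add: frac_int_diff)
    moreover have "\<bar>frac_int (\<alpha> + \<beta>) (\<lambda>s. y s - P s) t\<bar> \<le> \<epsilon> * ?C"
      using assms pos cn y_cont P_cont
      by (intro frac_int_bound continuous_on_diff) (auto simp: P_def)
    then have "\<bar>frac_int (\<alpha> + \<beta>) y t - frac_int (\<alpha> + \<beta>) P t\<bar> \<le> \<epsilon> * ?C"
      using assms y_cont P_cont by (simp add: frac_int_diff)
    ultimately show ?thesis
      unfolding P_semigroup distrib_left by (simp add: mult.assoc)
  qed
  have "?D \<le> 0"
  proof (rule field_le_epsilon)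
    fix e :: real assume "e > 0"
    have "Gamma (1 + \<alpha>) > 0" "Gamma (1 + \<beta>) > 0" "Gamma (1 + (\<alpha> + \<beta>)) > 0"
      using pos by simp_all
    then obtain K where K: "K = ?B * ?A + ?C" "K \<ge> 0" by simp
    \<comment> \<open>The \<open>+ 1\<close> covers \<open>K = 0\<close>, which occurs for
      \<open>T = 0\<close>.\<close>
    have "?D \<le> e / (K + 1) * K"
      unfolding K(1) using K \<open>e > 0\<close> by (intro bound) simp
    also have "\<dots> \<le> e"
      using K(2) \<open>e > 0\<close> by (simp add: field_simps)
    finally show "?D \<le> 0 + e" by simp
  qed
  then show ?thesis by simp
qed auto

section \<open>Iterated derivatives\<close>

text \<open>No differentiability is assumed: \<open>vector_derivative\<close> chooses among the
  candidate derivatives, and \<open>u\<close> and \<open>v\<close> have the same candidates because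
  only values on \<open>{0..T}\<close> enter.\<close>

lemma nderiv_cong:
  assumes "\<And>s. s \<in> {0..T} \<Longrightarrow> u s = v s" "t \<in> {0..T}"
  shows "nderiv T k u t = nderiv T k v t"
  using assms(2)
proof (induction k arbitrary: t)
  case (Suc k)
  have "(nderiv T k u has_vector_derivative d) (at t within {0..T}) \<longleftrightarrow>
        (nderiv T k v has_vector_derivative d) (at t within {0..T})" for d
    using Suc by (metis has_vector_derivative_transform)
  then show ?case by (simp add: vector_derivative_def)
qed (use assms in auto)

text \<open>An explicit chain \<open>D\<close> identifies the iterated derivatives, since
  \<open>T > 0\<close> makes derivatives within the interval unique.\<close>

lemma nderiv_eqI:
  assumes "T > 0" "\<And>t. t \<in> {0..T} \<Longrightarrow> D 0 t = u t"
    and "\<And>k t. k < l \<Longrightarrow> t \<in> {0..T} \<Longrightarrow> (D k has_vector_derivative D (Suc k) t) (at t within {0..T})"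
    and "k \<le> l" "t \<in> {0..T}"
  shows "nderiv T k u t = D k t"
  using assms(4,5)
proof (induction k arbitrary: t)
  case (Suc k)
  have "(nderiv T k u has_vector_derivative D (Suc k) t) (at t within {0..T})"
    using Suc assms(3)[of k t] by - (rule has_vector_derivative_transform[of t _ _ "D k"], auto)
  then show ?case
    using Suc.prems assms(1) by (simp add: vector_derivative_within_closed_interval)
qed (use assms(2) in auto)

lemma ndifferentiableI:
  assumes "T > 0" "\<And>t. t \<in> {0..T} \<Longrightarrow> D 0 t = u t"
    and "\<And>k t. k < l \<Longrightarrow> t \<in> {0..T} \<Longrightarrow> (D k has_vector_derivative D (Suc k) t) (at t within {0..T})"
  shows "ndifferentiable T l u"
  unfolding ndifferentiable_def differentiable_on_def
proof (intro allI impI ballI)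
  fix k t assume kt: "k < l" "t \<in> {0..T}"
  have "(nderiv T k u has_vector_derivative D (Suc k) t) (at t within {0..T})"
    using kt nderiv_eqI[of T D u l k] assms
    by - (rule has_vector_derivative_transform[of t _ _ "D k"], auto)
  then show "nderiv T k u differentiable at t within {0..T}"
    by (rule differentiableI_vector)
qed

lemma C_class_Suc_imp:
  assumes "C_class T (Suc l) u"
  shows "C_class T l u"
    and "t \<in> {0..T} \<Longrightarrow>
      (nderiv T l u has_vector_derivative nderiv T (Suc l) u t) (at t within {0..T})"
proof -
  have diff: "nderiv T l u differentiable_on {0..T}"
    using assms by (simp add: C_class_def ndifferentiable_def)
  then show "C_class T l u"
    using assms differentiable_imp_continuous_on[OF diff]
    by (auto simp: C_class_def ndifferentiable_def)
  show "(nderiv T l u has_vector_derivative nderiv T (Suc l) u t) (at t within {0..T})"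
    if "t \<in> {0..T}"
    using diff that by (simp add: differentiable_on_def vector_derivative_works)
qed

section \<open>Derivatives of fractional integrals and Taylor's formula\<close>

lemma frac_int_1:
  assumes "t \<ge> 0"
  shows "frac_int 1 y t = integral {0..t} y"
proof -
  have "integral {0..t} (\<lambda>\<tau>. (t - \<tau>) powr (1 - 1) * y \<tau>) = integral {0..t} y"
    \<comment> \<open>The kernel \<open>(t - \<tau>) powr 0\<close> is \<open>1\<close> except at
      \<open>\<tau> = t\<close>, where it is \<open>0\<close>.\<close>
    by (rule integral_spike[of "{t}"]) auto
  then show ?thesis by (simp add: frac_int_def)
qed

lemma frac_int_1_has_vector_derivative:
  assumes "continuous_on {0..T} y" "t \<in> {0..T}"
  shows "(frac_int 1 y has_vector_derivative y t) (at t within {0..T})"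
  using integral_has_vector_derivative[OF assms] assms(2)
  by (rule has_vector_derivative_transform[rotated 2]) (simp add: frac_int_1)

text \<open>By the semigroup law one ordinary integration can be split off from order
  \<open>\<beta> \<ge> 1\<close>; the fundamental theorem of calculus removes it.\<close>

lemma frac_int_has_vector_derivative:
  assumes "\<beta> \<ge> 1" "continuous_on {0..T} y" "t \<in> {0..T}"
  shows "(frac_int \<beta> y has_vector_derivative frac_int (\<beta> - 1) y t) (at t within {0..T})"
proof (rule has_vector_derivative_transform)
  show "(frac_int 1 (frac_int (\<beta> - 1) y) has_vector_derivative frac_int (\<beta> - 1) y t)
      (at t within {0..T})"
    using assms by (intro frac_int_1_has_vector_derivative continuous_on_frac_int) auto
qed (use assms in \<open>auto simp: frac_int_semigroup\<close>)

text \<open>The summand \<open>k = j\<close> is constant and drops out. For \<open>j \<ge> N\<close>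
  both sums are empty.\<close>

lemma has_vector_derivative_taylor_poly:
  fixes c :: "nat \<Rightarrow> real"
  shows "((\<lambda>t. \<Sum>k\<in>{j..<N}. c k * t ^ (k - j) / fact (k - j)) has_vector_derivative
      (\<Sum>k\<in>{Suc j..<N}. c k * t ^ (k - Suc j) / fact (k - Suc j))) (at t within S)"
proof (cases "j < N")
  case True
  have summand: "((\<lambda>t. c k * t ^ (k - j) / fact (k - j)) has_real_derivative
      c k * t ^ (k - Suc j) / fact (k - Suc j)) (at t within S)" if "k \<in> {Suc j..<N}" for k
  proof -
    have eq: "k - j = Suc (k - Suc j)" using that by auto
    show ?thesis
      unfolding eq by (rule derivative_eq_intros refl | simp)+
  qed
  have "((\<lambda>t. c j + (\<Sum>k\<in>{Suc j..<N}. c k * t ^ (k - j) / fact (k - j))) has_real_derivative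
      0 + (\<Sum>k\<in>{Suc j..<N}. c k * t ^ (k - Suc j) / fact (k - Suc j))) (at t within S)"
    by (intro DERIV_add DERIV_const DERIV_sum summand)
  then show ?thesis
    using True by (simp add: sum.atLeast_Suc_lessThan[of j N] has_real_derivative_iff_has_vector_derivative)
qed simp

text \<open>Each differentiation drops the constant term of the polynomial and lowers the fractional
  order by one. The condition \<open>real l \<le> \<beta>\<close> keeps that order nonnegative
  through \<open>l\<close> steps.\<close>

lemma
  fixes c :: "nat \<Rightarrow> real" and l N :: nat
  assumes "T > 0" "real l \<le> \<beta>" "continuous_on {0..T} z"
    and u: "\<And>t. t \<in> {0..T} \<Longrightarrow> u t = (\<Sum>k<N. c k * t ^ k / fact k) + frac_int \<beta> z t"
  shows nderiv_poly_plus_frac_int: "\<And>k t. k \<le> l \<Longrightarrow> t \<in> {0..T} \<Longrightarrow>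
      nderiv T k u t =
        (\<Sum>i\<in>{k..<N}. c i * t ^ (i - k) / fact (i - k)) + frac_int (\<beta> - real k) z t"
    and C_class_poly_plus_frac_int: "C_class T l u"
proof -
  define D where "D k t =
    (\<Sum>i\<in>{k..<N}. c i * t ^ (i - k) / fact (i - k)) + frac_int (\<beta> - real k) z t" for k t
  have D0: "D 0 t = u t" if "t \<in> {0..T}" for t
    using u[OF that] by (simp add: D_def atLeast0LessThan)
  have D_deriv: "(D k has_vector_derivative D (Suc k) t) (at t within {0..T})"
    if "k < l" "t \<in> {0..T}" for k t
  proof -
    have eq: "\<beta> - real (Suc k) = \<beta> - real k - 1" by simp
    have "\<beta> - real k \<ge> 1" using that assms(2) by linarith
    then show ?thesis
      unfolding D_def eq using that assms(3)
      by (intro has_vector_derivative_add has_vector_derivative_taylor_poly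
          frac_int_has_vector_derivative)
  qed
  show nd: "nderiv T k u t =
      (\<Sum>i\<in>{k..<N}. c i * t ^ (i - k) / fact (i - k)) + frac_int (\<beta> - real k) z t"
    if "k \<le> l" "t \<in> {0..T}" for k t
    using nderiv_eqI[of T D u l k t, OF assms(1) D0 D_deriv] that unfolding D_def by blast
  have "continuous_on {0..T} (nderiv T l u)"
  proof (rule continuous_on_eq)
    show "continuous_on {0..T} (\<lambda>t.
        (\<Sum>i\<in>{l..<N}. c i * t ^ (i - l) / fact (i - l)) + frac_int (\<beta> - real l) z t)"
      using assms(2,3) by (intro continuous_intros continuous_on_frac_int) auto
  qed (use nd in simp)
  then show "C_class T l u"
    using ndifferentiableI[of T D u l, OF assms(1) D0 D_deriv] by (simp add: C_class_def)
qed

lemma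
  fixes l :: nat
  assumes "T > 0" "real l \<le> \<beta>" "continuous_on {0..T} z"
    and "\<And>t. t \<in> {0..T} \<Longrightarrow> u t = frac_int \<beta> z t"
  shows nderiv_frac_int: "\<And>k t. k \<le> l \<Longrightarrow> t \<in> {0..T} \<Longrightarrow>
      nderiv T k u t = frac_int (\<beta> - real k) z t"
    and C_class_frac_int: "C_class T l u"
  using nderiv_poly_plus_frac_int[where N = 0, of T l \<beta> z u]
    C_class_poly_plus_frac_int[where N = 0, of T l \<beta> z u] assms
  by auto

text \<open>A further integral of order \<open>real N - \<beta>\<close> raises the order to an
  integer \<open>N\<close>, and \<open>N\<close> differentiations then recover the function.\<close>

lemma frac_int_inject:
  assumes "T > 0" "\<beta> \<ge> 0" "continuous_on {0..T} y" "continuous_on {0..T} z"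
    and "\<And>s. s \<in> {0..T} \<Longrightarrow> frac_int \<beta> y s = frac_int \<beta> z s"
    and "t \<in> {0..T}"
  shows "y t = z t"
proof -
  define N where "N = nat \<lceil>\<beta>\<rceil>"
  have N: "real N - \<beta> \<ge> 0" by (simp add: N_def real_nat_ceiling_ge)
  have "frac_int (real N) y s = frac_int (real N) z s" if "s \<in> {0..T}" for s
  proof -
    have "frac_int (real N - \<beta>) (frac_int \<beta> y) s = frac_int (real N - \<beta>) (frac_int \<beta> z) s"
      using assms(5) that by - (rule frac_int_cong, auto)
    then show ?thesis
      using frac_int_semigroup[OF N assms(2)] assms(3,4) that by simp
  qed
  then have "nderiv T N (frac_int (real N) y) t = nderiv T N (frac_int (real N) z) t"
    using assms(6) by (rule nderiv_cong)
  moreover have "nderiv T N (frac_int (real N) y) t = y t" "nderiv T N (frac_int (real N) z) t = z t"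
    using assms nderiv_frac_int[of T N "real N" y "frac_int (real N) y" N t]
      nderiv_frac_int[of T N "real N" z "frac_int (real N) z" N t] by simp_all
  ultimately show ?thesis by simp
qed

text \<open>In the induction step the \<open>l\<close>-th derivative inside the remainder is
  replaced by its value at \<open>0\<close> plus the integral of the next derivative. The constant
  yields the new Taylor term, the integral the new remainder by the semigroup law.\<close>

lemma taylor_formula:
  assumes "C_class T l u" "t \<in> {0..T}"
  shows "u t = (\<Sum>k<l. nderiv T k u 0 * t ^ k / fact k) + frac_int (real l) (nderiv T l u) t"
  using assms(1)
proof (induction l)
  case (Suc l)
  let ?g = "nderiv T l u" and ?g' = "nderiv T (Suc l) u"
  have g: "continuous_on {0..T} ?g" and g': "continuous_on {0..T} ?g'"
    using Suc.prems C_class_Suc_imp(1)[OF Suc.prems]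
    by (simp_all add: C_class_def del: nderiv.simps)
  have FTC: "?g s = ?g 0 + frac_int 1 ?g' s" if "s \<in> {0..t}" for s
  proof -
    have "(?g' has_integral ?g s - ?g 0) {0..s}"
    proof (rule fundamental_theorem_of_calculus)
      show "(?g has_vector_derivative ?g' r) (at r within {0..s})" if "r \<in> {0..s}" for r
        by (rule has_vector_derivative_within_subset[OF C_class_Suc_imp(2)[OF Suc.prems]])
          (use that \<open>s \<in> {0..t}\<close> assms(2) in auto)
    qed (use that in auto)
    then show ?thesis
      using that by (simp add: frac_int_1 integral_unique del: nderiv.simps)
  qed
  have sub: "continuous_on {0..t} ?g'"
    using g' assms(2) by (auto intro: continuous_on_subset)
  have "frac_int (real l) ?g t = frac_int (real l) (\<lambda>s. ?g 0 + frac_int 1 ?g' s) t"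
  proof (rule frac_int_cong)
    show "?g s = ?g 0 + frac_int 1 ?g' s" if "s \<in> {0..t}" for s
      using FTC[OF that] .
  qed (use assms(2) in auto)
  also have "\<dots> = ?g 0 * t ^ l / fact l + frac_int (real l) (frac_int 1 ?g') t"
    using assms(2) sub
    by (subst frac_int_add)
      (auto simp: frac_int_const simp del: nderiv.simps intro!: continuous_on_frac_int)
  also have "frac_int (real l) (frac_int 1 ?g') t = frac_int (real (Suc l)) ?g' t"
    using frac_int_semigroup[of "real l" 1 T ?g' t] g' assms(2) by (simp add: add.commute)
  finally show ?case
    using Suc C_class_Suc_imp(1) by (simp del: nderiv.simps)
qed simp

section \<open>The Caputo derivative as inverse of the fractional integral\<close>

lemma frac_ord_eq:
  assumes "real N - 1 < \<beta>" "\<beta> \<le> real N"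
  shows "frac_ord \<beta> = N"
  using assms ceiling_unique[of "int N" \<beta>] by (simp add: frac_ord_def)

text \<open>Whether \<open>u\<close> is in the class \<open>C_class T N\<close> is left open, so
  both branches of \<open>caputo_deriv\<close> must give \<open>z\<close>. In the Riemann-Liouville
  branch the remainder becomes the \<open>N\<close>-fold integral of \<open>z\<close>, which is
  differentiated \<open>N\<close> times. In the smooth branch Taylor's formula equates two integrals
  of order \<open>\<beta>\<close>, and injectivity cancels them.\<close>

lemma
  fixes c :: "nat \<Rightarrow> real"
  assumes T: "T > 0" and N: "N \<ge> 1" "real N - 1 < \<beta>" "\<beta> \<le> real N"
    and z: "continuous_on {0..T} z"
    and u: "\<And>t. t \<in> {0..T} \<Longrightarrow> u t = (\<Sum>k<N. c k * t ^ k / fact k) + frac_int \<beta> z t"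
  shows nderiv_0_poly_plus_frac_int: "\<And>k. k < N \<Longrightarrow> nderiv T k u 0 = c k"
    and caputo_differentiable_poly_plus_frac_int: "caputo_differentiable T \<beta> u"
    and caputo_deriv_poly_plus_frac_int: "\<And>t. t \<in> {0..T} \<Longrightarrow> caputo_deriv T \<beta> u t = z t"
proof -
  have ord: "frac_ord \<beta> = N" using N by (simp add: frac_ord_eq)
  have \<beta>: "\<beta> > 0" "real (N - 1) \<le> \<beta>" using N by linarith+
  show c: "nderiv T k u 0 = c k" if "k < N" for k
  proof -
    \<comment> \<open>The order \<open>\<beta> - real k\<close> left after \<open>k\<close>
      derivatives is positive, so the fractional part vanishes at \<open>0\<close> and only the
      constant term \<open>c k\<close> remains.\<close>
    have "real k < \<beta>" using that N by linarith
    have "(\<Sum>i\<in>{Suc k..<N}. c i * 0 ^ (i - k) / fact (i - k)) = 0"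
      by (intro sum.neutral) auto
    then have at_0: "(\<Sum>i\<in>{k..<N}. c i * 0 ^ (i - k) / fact (i - k)) = c k"
      using that by (simp add: sum.atLeast_Suc_lessThan[of k N])
    have "nderiv T k u 0 =
        (\<Sum>i\<in>{k..<N}. c i * 0 ^ (i - k) / fact (i - k)) + frac_int (\<beta> - real k) z 0"
      by (rule nderiv_poly_plus_frac_int[OF T \<beta>(2) z u]) (use that T in auto)
    also have "\<dots> = c k"
      unfolding at_0 using \<open>real k < \<beta>\<close> by (simp add: frac_int_at_0)
    finally show ?thesis .
  qed
  have rem: "taylor_remainder T N u t = frac_int \<beta> z t" if "t \<in> {0..T}" for t
    using u[OF that] c by (simp add: taylor_remainder_def)
  have RL: "frac_int (real N - \<beta>) (taylor_remainder T N u) t = frac_int (real N) z t"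
    if "t \<in> {0..T}" for t
  proof -
    have "frac_int (real N - \<beta>) (taylor_remainder T N u) t = frac_int (real N - \<beta>) (frac_int \<beta> z) t"
      using that rem by - (rule frac_int_cong, auto)
    then show ?thesis
      using frac_int_semigroup[of "real N - \<beta>" \<beta> T z t] N \<beta> z that by simp
  qed
  have "RL_differentiable T \<beta> (taylor_remainder T N u)"
    using C_class_frac_int[OF T order_refl z RL] by (simp add: RL_differentiable_def ord C_class_def)
  then show "caputo_differentiable T \<beta> u"
    using C_class_poly_plus_frac_int[OF T \<beta>(2) z u] by (simp add: caputo_differentiable_def ord)
  show "caputo_deriv T \<beta> u t = z t" if t: "t \<in> {0..T}" for t
  proof (cases "C_class T N u")
    case True
    define g where "g = nderiv T N u"
    have g: "continuous_on {0..T} g" using True by (simp add: C_class_def g_def)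
    have Ig: "continuous_on {0..T} (frac_int (real N - \<beta>) g)"
      using N by (intro continuous_on_frac_int g) auto
    have "frac_int \<beta> (frac_int (real N - \<beta>) g) s = frac_int \<beta> z s" if s: "s \<in> {0..T}" for s
    proof -
      have "frac_int \<beta> (frac_int (real N - \<beta>) g) s = frac_int (real N) g s"
        using frac_int_semigroup[of \<beta> "real N - \<beta>" T g s] N \<beta> g s by simp
      also have "\<dots> = frac_int \<beta> z s"
        using taylor_formula[OF True s] u[OF s] c by (simp add: g_def)
      finally show ?thesis .
    qed
    then have "frac_int (real N - \<beta>) g t = z t"
      using T \<beta> Ig z t by - (rule frac_int_inject[of T \<beta>], auto)
    then show ?thesis
      using True by (simp add: caputo_deriv_def ord g_def)
  next
    case False
    then have "caputo_deriv T \<beta> u t = nderiv T N (frac_int (real N - \<beta>) (taylor_remainder T N u)) t"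
      by (simp add: caputo_deriv_def RL_deriv_def ord)
    also have "\<dots> = z t"
      using nderiv_frac_int[OF T order_refl z RL order_refl t] by simp
    finally show ?thesis .
  qed
qed

text \<open>For \<open>u\<close> in \<open>C_class T N\<close> this is Taylor's formula combined
  with the semigroup law. Otherwise only the fractional integral of the remainder is known to be
  \<open>N\<close> times differentiable, and the work lies in its initial values.\<close>

lemma caputo_deriv_inverse:
  assumes T: "T > 0" and N: "N \<ge> 1" "real N - 1 < \<beta>" "\<beta> \<le> real N"
    and diff: "caputo_differentiable T \<beta> u"
    and cont: "continuous_on {0..T} (caputo_deriv T \<beta> u)" and t: "t \<in> {0..T}"
  shows "u t = (\<Sum>k<N. nderiv T k u 0 * t ^ k / fact k) + frac_int \<beta> (caputo_deriv T \<beta> u) t"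
proof -
  have ord: "frac_ord \<beta> = N" using N by (simp add: frac_ord_eq)
  have \<beta>: "\<beta> > 0" using N by linarith
  show ?thesis
  proof (cases "C_class T N u")
    case True
    have "frac_int \<beta> (caputo_deriv T \<beta> u) t = frac_int (real N) (nderiv T N u) t"
      using True frac_int_semigroup[of \<beta> "real N - \<beta>" T "nderiv T N u" t] N \<beta> t
      by (simp add: caputo_deriv_def ord C_class_def)
    then show ?thesis using taylor_formula[OF True t] by simp
  next
    case False
    txt \<open>The initial derivatives of \<open>v = I\<^bsup>N - \<beta>\<^esup> w\<close> vanish, so Taylor's formula gives
      \<open>v = I\<^sup>N y = I\<^bsup>N - \<beta>\<^esup> I\<^sup>\<beta> y\<close>, and \<open>I\<^bsup>N - \<beta>\<^esup>\<close> can be cancelled.\<close>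
    define w where "w = taylor_remainder T N u"
    define v where "v = frac_int (real N - \<beta>) w"
    define g where "g = nderiv T (N - 1) u"
    define h where "h = (\<lambda>s. g s - g 0)"
    have caputo: "caputo_deriv T \<beta> u = nderiv T N v"
      using False by (simp add: caputo_deriv_def RL_deriv_def ord v_def w_def)
    have Cu: "C_class T (N - 1) u" and "ndifferentiable T N v"
      using diff False by (auto simp: caputo_differentiable_def RL_differentiable_def ord v_def w_def)
    then have Cv: "C_class T N v" using cont caputo by (simp add: C_class_def)
    have g: "continuous_on {0..T} g" using Cu by (simp add: C_class_def g_def)
    then have h: "continuous_on {0..T} h" unfolding h_def by (intro continuous_intros)
    have h0: "h 0 = 0" by (simp add: h_def)
    have w: "w s = frac_int (real (N - 1)) h s" if s: "s \<in> {0..T}" for s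
    proof -
      have sub: "continuous_on {0..s} g" using g s by (auto intro: continuous_on_subset)
      have "frac_int (real (N - 1)) h s =
          frac_int (real (N - 1)) g s - g 0 * s ^ (N - 1) / fact (N - 1)"
        unfolding h_def using sub s by (subst frac_int_diff) (auto simp: frac_int_const simp del: of_nat_diff)
      \<comment> \<open>Taylor's formula is available only for \<open>N - 1\<close> derivatives,
        while \<open>w\<close> subtracts \<open>N\<close> terms. The extra one is the integral of
        order \<open>N - 1\<close> of the constant \<open>g 0\<close>, which explains the shift from
        \<open>g\<close> to \<open>h\<close>.\<close>
      moreover have "(\<Sum>k<N. nderiv T k u 0 * s ^ k / fact k) =
          (\<Sum>k<N - 1. nderiv T k u 0 * s ^ k / fact k) + g 0 * s ^ (N - 1) / fact (N - 1)"
        using N(1) by (cases N) (simp_all add: g_def)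
      ultimately show ?thesis
        using taylor_formula[OF Cu s] by (simp add: w_def taylor_remainder_def g_def)
    qed
    have w_cont: "continuous_on {0..T} w"
      using continuous_on_frac_int[of "real (N - 1)" T h] h w
      by - (rule continuous_on_eq[of _ "frac_int (real (N - 1)) h"], auto)
    define q where "q = frac_int (real N - \<beta>) h"
    have q: "continuous_on {0..T} q"
      unfolding q_def using N h by (intro continuous_on_frac_int) auto
    \<comment> \<open>For \<open>\<beta> = real N\<close> the integral is the identity and the value
      is \<open>h 0\<close>; otherwise the interval of integration is degenerate.\<close>
    have q0: "q 0 = 0" using h0 by (simp add: q_def frac_int_def)
    have v: "v s = frac_int (real (N - 1)) q s" if s: "s \<in> {0..T}" for s
    proof -
      have "v s = frac_int (real N - \<beta>) (frac_int (real (N - 1)) h) s"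
        unfolding v_def using s w by - (rule frac_int_cong, auto)
      also have "\<dots> = frac_int (real (N - 1)) q s"
        using frac_int_semigroup[of "real N - \<beta>" "real (N - 1)" T h s]
          frac_int_semigroup[of "real (N - 1)" "real N - \<beta>" T h s] N s h
        by (simp add: q_def add.commute del: of_nat_diff)
      finally show ?thesis .
    qed
    have v0: "nderiv T k v 0 = 0" if "k < N" for k
    proof -
      have "nderiv T k v 0 = frac_int (real (N - 1) - real k) q 0"
        using that T by (intro nderiv_frac_int[OF T order_refl q v]) auto
      also have "\<dots> = 0"
        \<comment> \<open>For \<open>k = N - 1\<close> the remaining order is \<open>0\<close> and
          the value is \<open>q 0\<close>; for smaller \<open>k\<close> the order is
          positive.\<close>
        using q0 by (cases "k = N - 1") (auto simp: frac_int_def)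
      finally show ?thesis .
    qed
    define y where "y = caputo_deriv T \<beta> u"
    have y: "continuous_on {0..T} y" using cont by (simp add: y_def)
    have "w t = frac_int \<beta> y t"
    proof (rule frac_int_inject[OF T _ w_cont _ _ t])
      show "frac_int (real N - \<beta>) w s = frac_int (real N - \<beta>) (frac_int \<beta> y) s"
        if s: "s \<in> {0..T}" for s
      proof -
        have "v s = frac_int (real N) y s"
          using taylor_formula[OF Cv s] v0 by (simp add: y_def caputo)
        also have "\<dots> = frac_int (real N - \<beta>) (frac_int \<beta> y) s"
          using frac_int_semigroup[of "real N - \<beta>" \<beta> T y s] N \<beta> y s by simp
        finally show ?thesis by (simp add: v_def)
      qed
    qed (use N \<beta> y in \<open>auto intro: continuous_on_frac_int\<close>)
    then show ?thesis
      by (simp add: w_def y_def taylor_remainder_def)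
  qed
qed

text \<open>The monomials of degree at least \<open>N\<close> and \<open>I\<^sup>\<alpha> y\<close> are \<open>I\<^sup>\<beta>\<close> of continuous functions.\<close>

lemma
  fixes x0 :: "nat \<Rightarrow> real"
  assumes T: "T > 0" and N: "N \<ge> 1" "real N - 1 < \<beta>" "\<beta> \<le> real N" and "\<beta> \<le> \<alpha>"
    and nN: "N \<le> n" and y: "continuous_on {0..T} y"
    and x: "\<And>t. t \<in> {0..T} \<Longrightarrow> x t = frac_int \<alpha> y t + (\<Sum>k<n. x0 k * t ^ k / fact k)"
  shows caputo_differentiable_lower: "caputo_differentiable T \<beta> x"
    and caputo_deriv_lower: "\<And>t. t \<in> {0..T} \<Longrightarrow> caputo_deriv T \<beta> x t =
        frac_int (\<alpha> - \<beta>) y t + RL_deriv T \<beta> (\<lambda>s. \<Sum>k\<in>{N..<n}. x0 k * s ^ k / fact k) t"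
    and continuous_on_caputo_deriv_lower: "continuous_on {0..T} (\<lambda>t.
        frac_int (\<alpha> - \<beta>) y t + RL_deriv T \<beta> (\<lambda>s. \<Sum>k\<in>{N..<n}. x0 k * s ^ k / fact k) t)"
proof -
  have ord: "frac_ord \<beta> = N" using N by (simp add: frac_ord_eq)
  have \<beta>: "\<beta> > 0" using N by linarith
  define p where "p s = (\<Sum>k\<in>{N..<n}. x0 k * s ^ k / fact k)" for s :: real
  \<comment> \<open>This is the \<open>N\<close>-th derivative of \<open>p\<close>; all terms of
    \<open>p\<close> have degree at least \<open>N\<close>, so \<open>N\<close>-fold integration
    returns \<open>p\<close>.\<close>
  define q where "q s = (\<Sum>k\<in>{N..<n}. x0 k * (s ^ (k - N) / fact (k - N)))" for s :: real
  have q: "continuous_on S q" for S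
    unfolding q_def by (intro continuous_intros) auto
  have pq: "p s = frac_int (real N) q s" if "s \<ge> 0" for s
  proof -
    have "frac_int (real N) q s =
        (\<Sum>k\<in>{N..<n}. x0 k * frac_int (real N) (\<lambda>s. s ^ (k - N) / fact (k - N)) s)"
      unfolding q_def
      by (subst frac_int_sum)
        (auto simp: frac_int_cmult simp del: times_divide_eq_right intro!: continuous_intros)
    also have "\<dots> = p s"
      unfolding p_def using that frac_int_nat_power[of s N] by (intro sum.cong) auto
    finally show ?thesis by simp
  qed
  \<comment> \<open>The Riemann-Liouville derivative of \<open>p\<close>: fractional integrals
    commute, so the \<open>N\<close> derivatives cancel the \<open>N\<close>-fold integral in
    \<open>p\<close>.\<close>
  define r where "r = frac_int (real N - \<beta>) q"
  have r: "continuous_on {0..T} r"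
    unfolding r_def using N q by (intro continuous_on_frac_int) auto
  have Ir: "frac_int (real N - \<beta>) p t = frac_int (real N) r t" if t: "t \<in> {0..T}" for t
  proof -
    have "frac_int (real N - \<beta>) p t = frac_int (real N - \<beta>) (frac_int (real N) q) t"
      using t pq by - (rule frac_int_cong, auto)
    also have "\<dots> = frac_int (real N) r t"
      using frac_int_semigroup[of "real N - \<beta>" "real N" T q t]
        frac_int_semigroup[of "real N" "real N - \<beta>" T q t] N t q
      by (simp add: r_def add.commute)
    finally show ?thesis .
  qed
  have RL: "RL_deriv T \<beta> p t = r t" if "t \<in> {0..T}" for t
    using nderiv_frac_int[OF T order_refl r Ir order_refl that] by (simp add: RL_deriv_def ord)
  define z where "z t = frac_int (\<alpha> - \<beta>) y t + r t" for t
  have Iy: "continuous_on {0..T} (frac_int (\<alpha> - \<beta>) y)"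
    using \<open>\<beta> \<le> \<alpha>\<close> y by (intro continuous_on_frac_int) auto
  then have z: "continuous_on {0..T} z"
    unfolding z_def by (intro continuous_intros r)
  \<comment> \<open>Integrating \<open>z\<close> to order \<open>\<beta>\<close> gives
    \<open>frac_int \<alpha> y\<close> plus \<open>p\<close>, and \<open>p\<close> is exactly the
    part of the initial polynomial from degree \<open>N\<close> on.\<close>
  have x': "x t = (\<Sum>k<N. x0 k * t ^ k / fact k) + frac_int \<beta> z t" if t: "t \<in> {0..T}" for t
  proof -
    have "frac_int \<beta> z t = frac_int \<beta> (frac_int (\<alpha> - \<beta>) y) t + frac_int \<beta> r t"
      unfolding z_def using \<beta> t Iy r
      by (intro frac_int_add) (auto intro: continuous_on_subset)
    also have "frac_int \<beta> (frac_int (\<alpha> - \<beta>) y) t = frac_int \<alpha> y t"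
      using frac_int_semigroup[of \<beta> "\<alpha> - \<beta>" T y t] \<beta> \<open>\<beta> \<le> \<alpha>\<close> y t by simp
    also have "frac_int \<beta> r t = p t"
      using frac_int_semigroup[of \<beta> "real N - \<beta>" T q t] \<beta> N q t pq[of t] by (simp add: r_def)
    moreover have "(\<Sum>k<n. x0 k * t ^ k / fact k) = (\<Sum>k<N. x0 k * t ^ k / fact k) + p t"
      unfolding p_def lessThan_atLeast0 using nN by (simp add: sum.atLeastLessThan_concat)
    ultimately show ?thesis using x[OF t] by simp
  qed
  show "caputo_differentiable T \<beta> x"
    by (rule caputo_differentiable_poly_plus_frac_int[OF T N z x'])
  have eq: "z t = frac_int (\<alpha> - \<beta>) y t + RL_deriv T \<beta> (\<lambda>s. \<Sum>k\<in>{N..<n}. x0 k * s ^ k / fact k) t"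
    if "t \<in> {0..T}" for t
    using RL[OF that] by (simp add: z_def p_def[abs_def])
  then show "caputo_deriv T \<beta> x t =
      frac_int (\<alpha> - \<beta>) y t + RL_deriv T \<beta> (\<lambda>s. \<Sum>k\<in>{N..<n}. x0 k * s ^ k / fact k) t"
    if "t \<in> {0..T}" for t
    using caputo_deriv_poly_plus_frac_int[OF T N z x' that] that by simp
  show "continuous_on {0..T} (\<lambda>t.
      frac_int (\<alpha> - \<beta>) y t + RL_deriv T \<beta> (\<lambda>s. \<Sum>k\<in>{N..<n}. x0 k * s ^ k / fact k) t)"
    using z eq by (rule continuous_on_eq)
qed

section \<open>Equivalence of the two problems\<close>

theorem lemma1:
  fixes T \<alpha> :: real and m n :: nat and a :: "nat \<Rightarrow> real" and N :: "nat \<Rightarrow> nat"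
    and f :: "real \<times> real \<times> (nat \<Rightarrow> real) \<Rightarrow> real" and x0 :: "nat \<Rightarrow> real"
  assumes "T > 0" and "m \<ge> 1" and "n \<ge> 1"
    and "real n - 1 < \<alpha>" and "\<alpha> \<le> real n"
    and "\<forall>i\<in>{1..m}. 0 < a i \<and> a i < \<alpha>"
    and "\<forall>i\<in>{1..m}. \<forall>j\<in>{1..m}. i < j \<longrightarrow> a j < a i"
    and "\<forall>i\<in>{1..m}. N i \<ge> 1 \<and> real (N i) - 1 < a i \<and> a i \<le> real (N i)"
    and "continuous_on ({0..T} \<times> UNIV \<times> ({1..m} \<rightarrow>\<^sub>E UNIV)) f"
  shows "(\<forall>x y. solves_ivp T m n \<alpha> a f x0 x \<and> (\<forall>t\<in>{0..T}. caputo_deriv T \<alpha> x t = y t)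
            \<longrightarrow> continuous_on {0..T} y \<and> solves_integral_eq T m n \<alpha> a N f x0 y)
       \<and> (\<forall>y x. continuous_on {0..T} y \<and> solves_integral_eq T m n \<alpha> a N f x0 y
              \<and> (\<forall>t\<in>{0..T}. x t = frac_int \<alpha> y t + (\<Sum>k<n. x0 k * t ^ k / fact k))
            \<longrightarrow> solves_ivp T m n \<alpha> a f x0 x)"
proof -
  define z where "z y i t = frac_int (\<alpha> - a i) y t
      + RL_deriv T (a i) (\<lambda>s. \<Sum>k\<in>{N i..<n}. x0 k * s ^ k / fact k) t" for y i t
  have lower: "caputo_differentiable T (a i) x"
    "\<And>t. t \<in> {0..T} \<Longrightarrow> caputo_deriv T (a i) x t = z y i t" "continuous_on {0..T} (z y i)"
    if "i \<in> {1..m}" "continuous_on {0..T} y"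
      and "\<And>t. t \<in> {0..T} \<Longrightarrow> x t = frac_int \<alpha> y t + (\<Sum>k<n. x0 k * t ^ k / fact k)" for x y i
  proof -
    have i: "N i \<ge> 1" "real (N i) - 1 < a i" "a i \<le> real (N i)" "a i \<le> \<alpha>"
      using bspec[OF assms(8) that(1)] bspec[OF assms(6) that(1)] by auto
    \<comment> \<open>From \<open>real (N i) < a i + 1 \<le> real n + 1\<close>, as both are
      integers.\<close>
    then have "N i \<le> n" using assms(5) by linarith
    note lower = assms(1) i this that(2,3)
    show "caputo_differentiable T (a i) x"
      by (rule caputo_differentiable_lower[OF lower])
    show "caputo_deriv T (a i) x t = z y i t" if "t \<in> {0..T}" for t
      unfolding z_def by (rule caputo_deriv_lower[OF lower that])
    show "continuous_on {0..T} (z y i)"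
      unfolding z_def[abs_def] by (rule continuous_on_caputo_deriv_lower[OF lower])
  qed
  have part_a: "continuous_on {0..T} y \<and> solves_integral_eq T m n \<alpha> a N f x0 y"
    if sol: "solves_ivp T m n \<alpha> a f x0 x" and y: "\<And>t. t \<in> {0..T} \<Longrightarrow> caputo_deriv T \<alpha> x t = y t"
    for x y
  proof -
    have cont: "continuous_on {0..T} (caputo_deriv T \<alpha> x)"
      using sol by (simp add: solves_ivp_def)
    then have y_cont: "continuous_on {0..T} y"
      using y by (rule continuous_on_eq)
    have x: "x t = frac_int \<alpha> y t + (\<Sum>k<n. x0 k * t ^ k / fact k)" if t: "t \<in> {0..T}" for t
    proof -
      have "frac_int \<alpha> (caputo_deriv T \<alpha> x) t = frac_int \<alpha> y t"
        using t y by (intro frac_int_cong) auto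
      then show ?thesis
        using caputo_deriv_inverse[of T n \<alpha> x t] assms(1,3-5) sol cont t
        by (simp add: solves_ivp_def)
    qed
    let ?r = "\<lambda>t. f (t, x t, \<lambda>i\<in>{1..m}. z y i t)"
    \<comment> \<open>Continuity into the product is checked at every index \<open>j\<close>;
      outside \<open>{1..m}\<close> the restricted function has a fixed default value.\<close>
    have "continuous_on {0..T} (\<lambda>t. (\<lambda>i\<in>{1..m}. z y i t) j)" for j
      using lower(3)[of j y x, OF _ y_cont x] by (cases "j \<in> {1..m}") auto
    then have "continuous_on {0..T} (\<lambda>t. \<lambda>i\<in>{1..m}. z y i t)"
      by (rule continuous_on_coordinatewise_then_product)
    moreover have "continuous_on {0..T} x"
      using sol by (simp add: solves_ivp_def)
    ultimately have r_cont: "continuous_on {0..T} ?r"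
      by (intro continuous_on_compose2[OF assms(9)] continuous_on_Pair continuous_on_id) auto
    have pos: "y t = ?r t" if t: "t \<in> {0<..T}" for t
    proof -
      have "(\<lambda>i\<in>{1..m}. caputo_deriv T (a i) x t) = (\<lambda>i\<in>{1..m}. z y i t)"
        using t lower(2)[of _ y x, OF _ y_cont x] by (intro restrict_ext) auto
      then show ?thesis
        using sol y[of t] t by (simp add: solves_ivp_def)
    qed
    \<comment> \<open>The differential equation says nothing at \<open>t = 0\<close>; the continuous
      difference vanishes on \<open>{0<..T}\<close>, hence on its closure.\<close>
    have "y t = ?r t" if t: "t \<in> {0..T}" for t
    proof -
      have closure: "closure {0<..T} = {0..T}"
        using assms(1) by (simp add: closure_greaterThanAtMost)
      have "continuous_on (closure {0<..T}) (\<lambda>t. y t - ?r t)"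
        unfolding closure by (intro continuous_on_diff y_cont r_cont)
      then have "y t - ?r t = 0"
        by (rule continuous_constant_on_closure) (use pos t closure in simp_all)
      then show ?thesis by simp
    qed
    then have "solves_integral_eq T m n \<alpha> a N f x0 y"
      using x by (simp add: solves_integral_eq_def z_def)
    with y_cont show ?thesis by simp
  qed
  have part_b: "solves_ivp T m n \<alpha> a f x0 x"
    if y: "continuous_on {0..T} y" and sol: "solves_integral_eq T m n \<alpha> a N f x0 y"
      and x: "\<And>t. t \<in> {0..T} \<Longrightarrow> x t = frac_int \<alpha> y t + (\<Sum>k<n. x0 k * t ^ k / fact k)"
    for x y
  proof -
    have x': "\<And>t. t \<in> {0..T} \<Longrightarrow> x t = (\<Sum>k<n. x0 k * t ^ k / fact k) + frac_int \<alpha> y t"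
      using x by simp
    have nderiv_0: "nderiv T j x 0 = x0 j" if "j < n" for j
      by (rule nderiv_0_poly_plus_frac_int[OF assms(1,3-5) y x' that])
    have differentiable: "caputo_differentiable T \<alpha> x"
      by (rule caputo_differentiable_poly_plus_frac_int[OF assms(1,3-5) y x'])
    have caputo: "caputo_deriv T \<alpha> x t = y t" if "t \<in> {0..T}" for t
      by (rule caputo_deriv_poly_plus_frac_int[OF assms(1,3-5) y x' that])
    have "continuous_on {0..T} x"
    proof (rule continuous_on_eq)
      show "continuous_on {0..T} (\<lambda>t. frac_int \<alpha> y t + (\<Sum>k<n. x0 k * t ^ k / fact k))"
        using assms(3,4) y by (intro continuous_intros continuous_on_frac_int) auto
    qed (use x in simp)
    moreover have "caputo_deriv T \<alpha> x t = f (t, x t, \<lambda>i\<in>{1..m}. caputo_deriv T (a i) x t)"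
      if t: "t \<in> {0<..T}" for t
    proof -
      have t': "t \<in> {0..T}" using t by auto
      have derivs: "(\<lambda>i\<in>{1..m}. caputo_deriv T (a i) x t) = (\<lambda>i\<in>{1..m}. z y i t)"
        using t' lower(2)[of _ y x, OF _ y x] by (intro restrict_ext) auto
      have "y t = f (t, frac_int \<alpha> y t + (\<Sum>k<n. x0 k * t ^ k / fact k), \<lambda>i\<in>{1..m}. z y i t)"
        using sol t' unfolding solves_integral_eq_def z_def by (rule bspec)
      then show ?thesis
        unfolding derivs caputo[OF t'] x[OF t'] .
    qed
    moreover have "continuous_on {0..T} (caputo_deriv T \<alpha> x)"
      using y by (rule continuous_on_eq) (use caputo in simp)
    ultimately show ?thesis
      using nderiv_0 differentiable lower(1)[of _ y x, OF _ y x] by (simp add: solves_ivp_def)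
  qed
  show ?thesis
    using part_a part_b by blast
qed

end
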